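(* Let $p(x,y)$ be a bivariate polynomial of degree $n$. Then the recursive algorithm $\mathcal{T}$ described in the context, applied to $p$, returns a representation tree $G$ for the linearization of $p$ whose size (number of nodes) is \[ \theta(n)=|G|=\begin{cases}\frac16 n(n+5), & n=3k\ \text{ or }\ n=3k+1,\\[2pt] \frac16 n(n+5)-\frac13, & n=3k+2,\end{cases} \] where $k$ is a nonnegative integer and $n\ge 1$.
   Context: A bivariate polynomial (with complex coefficients) has degree $n$ if all its monomials have total degree at most $n$ and at least one has total degree exactly $n$. Representation tree: a directed rooted tree in which each edge carries a linear form $\alpha x+\beta y$ with $(\alpha,\beta)\neq(0,0)$. The root is the polynomial $q_1=1$, and every other node is the polynomial equal to the product of the forms on the edges of the path from the root to it. Each node $q_k$ also carries a coefficient $f_k(x,y)=a_k+b_kx+c_ky$. The tree is a representation tree for the linearization of $p$ if $\sum_k f_k(x,y)q_k(x,y)=p(x,y)$. It then yields matrices $A,B,C$ of size $|G|\times|G|$ with $\det(A+xB+yC)=p(x,y)$: the first row of $A+xB+yC$ has $f_k$ in position $(1,k)$, and for each edge $q_k=(\alpha x+\beta y)q_j$ row $k$ has $-(\alpha x+\beta y)$ in position $(k,j)$, $1$ in position $(k,k)$, and zeros elsewhere. Algorithm $\mathcal{T}$. Input: $p(x,y)=\alpha_{00}+\alpha_{10}x+\alpha_{01}y+\cdots+\alpha_{n0}x^n+\alpha_{n-1,1}x^{n-1}y+\cdots+\alpha_{0n}y^n$ of degree $n$ with $\alpha_{n0}\ne0$. (If $\alpha_{n0}=0$, first substitute $x=\tilde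 x$, $y=\tilde y+\gamma\tilde x$, with $\gamma$ chosen so that the coefficient of $\tilde x^n$ is nonzero, complete the tree for the substituted polynomial, and then substitute back to $x,y$.) 1. Compute the $n$ zeros $\zeta_1,\dots,\zeta_n\in\mathbb{C}$ of $h(t)=\alpha_{n0}t^n+\alpha_{n-1,1}t^{n-1}+\cdots+\alpha_{0n}$. 2. Form a branch of the tree with root $q_1=1$ and nodes $q_2,\dots,q_n$, where $q_{k+1}$ is a successor of $q_k$ by an edge with factor $x-\zeta_ky$, $k=1,\dots,n-1$. 3. Set $f_1=\alpha_{00}+\alpha_{10}x+\alpha_{01}y$; $f_k=\alpha_{k0}x+(\alpha_{k-1,1}-\alpha_{k0}\beta_k)y$ for $k=2,\dots,n-1$, where $\beta_k$ is the coefficient of $x^{k-2}y$ in $q_k$; and, for $n\ge2$, $f_n=\alpha_{n0}(x-\zeta_ny)$. 4. Compute the remainder $r=p-\sum_{k=1}^nf_kq_k$, which has the form $r(x,y)=y^2s(x,y)$, where $s$ is a polynomial of degree $n-3$ (for $n=1,2$ the remainder is zero). 5. If $s\equiv0$, stop and return the tree. 6. Add a node $q_{n+1}$ and connect it to the root by an edge with factor $y$. 7. If $s$ is a nonzero constant $\beta_{00}$, use $f_{n+1}=\beta_{00}y$ as the coefficient of $q_{n+1}$, stop, and return the tree. 8. Recursively call the same algorithm to obtain a representation tree with root $q_1'$ for the polynomial $s$ (the node $q_{n+1}$ then has coefficient $f_{n+1}=0$). 9. Connect $q_{n+1}$ to $q_1'$ by an edge with factor $y$ (so all nodes of the subtree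 get multiplied by $y^2$), and return the tree with root $q_1$.
   Formalization: The size is proved to be at most θ(n) for every p, and equal to θ(n) when s has degree n−3, as step 4 says, at every stage of the recursion; without this, equality fails: p = x^4 gives s = 0 and a tree with 4 nodes, while θ(4) = 6. *)

theory Defs
  imports
    Complex_Main
    "HOL-Computational_Algebra.Computational_Algebra"
begin

section \<open>Bivariate polynomials\<close>

text \<open>
  A bivariate polynomial is a polynomial in \<open>y\<close> (outer variable) whose coefficients are
  polynomials in \<open>x\<close> (inner variable); \<open>cf p i j\<close> is the coefficient of \<open>x^i y^j\<close>.
\<close>

type_synonym bipoly = "complex poly poly"

definition cf :: "bipoly \<Rightarrow> nat \<Rightarrow> nat \<Rightarrow> complex" where
  "cf p i j = coeff (coeff p j) i"

definition varY :: bipoly where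
  "varY = [:0, 1:]"

definition has_degree :: "bipoly \<Rightarrow> nat \<Rightarrow> bool" where
  "has_degree p n \<longleftrightarrow>
     (\<forall>i j. cf p i j \<noteq> 0 \<longrightarrow> i + j \<le> n) \<and> (\<exists>i j. i + j = n \<and> cf p i j \<noteq> 0)"

text \<open>Meaningful for nonzero \<open>p\<close> only: the zero polynomial has no degree.\<close>

definition tdeg :: "bipoly \<Rightarrow> nat" where
  "tdeg p = (THE n. has_degree p n)"


section \<open>Representation trees\<close>

text \<open>
  A node carries a coefficient \<open>a + b x + c y\<close>, encoded as \<open>(a, b, c)\<close>, and the list of its
  successors, each with the linear form \<open>\<alpha> x + \<beta> y\<close> on the connecting edge, encoded as
  \<open>(\<alpha>, \<beta>)\<close>.  The polynomials \<open>q\<^sub>k\<close> at the nodes are not stored; they are determined by the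
  edges.
\<close>

type_synonym affine = "complex \<times> complex \<times> complex"
type_synonym form = "complex \<times> complex"

datatype ('f, 'e) tree = Node 'f "('e \<times> ('f, 'e) tree) list"

type_synonym rtree = "(affine, form) tree"

fun affine_poly :: "affine \<Rightarrow> bipoly" where
  "affine_poly (a, b, c) = [:[:a, b:], [:c:]:]"

fun form_poly :: "form \<Rightarrow> bipoly" where
  "form_poly (\<alpha>, \<beta>) = affine_poly (0, \<alpha>, \<beta>)"

fun edges :: "('f, 'e) tree \<Rightarrow> 'e list" where
  "edges (Node f ts) = concat (map (\<lambda>(e, t). e # edges t) ts)"

text \<open>
  All nodes as pairs \<open>(f\<^sub>k, q\<^sub>k)\<close>, where \<open>q\<close> is the polynomial at the root of the given tree.
\<close>

fun nodes_from :: "bipoly \<Rightarrow> rtree \<Rightarrow> (affine \<times> bipoly) list" where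
  "nodes_from q (Node f ts) =
     (f, q) # concat (map (\<lambda>(e, t). nodes_from (form_poly e * q) t) ts)"

definition nodes :: "rtree \<Rightarrow> (affine \<times> bipoly) list" where
  "nodes G = nodes_from 1 G"

definition num_nodes :: "rtree \<Rightarrow> nat" where
  "num_nodes G = length (nodes G)"

definition representation_tree :: "rtree \<Rightarrow> bipoly \<Rightarrow> bool" where
  "representation_tree G p \<longleftrightarrow>
     (\<forall>e \<in> set (edges G). e \<noteq> (0, 0)) \<and>
     (\<Sum>(f, q) \<leftarrow> nodes G. affine_poly f * q) = p"


section \<open>The algorithm\<close>

text \<open>
  The algorithm leaves two choices open: the order of the zeros of \<open>h\<close>, and the number \<open>\<gamma>\<close> used
  when the coefficient of \<open>x^n\<close> vanishes.  Both are modelled by parameters \<open>zs\<close> and \<open>gam\<close>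
  that assign a choice to every polynomial.  A run never makes the same choice twice for the same
  polynomial, so all runs are covered.
\<close>

definition top_poly :: "bipoly \<Rightarrow> complex poly" where
  "top_poly p = (\<Sum>i\<le>tdeg p. monom (cf p i (tdeg p - i)) i)"

text \<open>The substitution \<open>x := x\<close>, \<open>y := y + \<gamma> x\<close>.\<close>

definition shear :: "complex \<Rightarrow> bipoly \<Rightarrow> bipoly" where
  "shear \<gamma> p = pcompose p [:[:0, \<gamma>:], 1:]"

definition zeros_choice :: "(bipoly \<Rightarrow> complex list) \<Rightarrow> bool" where
  "zeros_choice zs \<longleftrightarrow> (\<forall>p. mset (zs p) = proots (top_poly p))"

definition shear_choice :: "(bipoly \<Rightarrow> complex) \<Rightarrow> bool" where
  "shear_choice gam \<longleftrightarrow>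
     (\<forall>p. p \<noteq> 0 \<longrightarrow> cf p (tdeg p) 0 = 0 \<longrightarrow> cf (shear (gam p) p) (tdeg p) 0 \<noteq> 0)"

text \<open>
  Substituting back means \<open>y := y - \<gamma> x\<close> in every coefficient and on every edge of the tree.
\<close>

definition unshear_tree :: "complex \<Rightarrow> rtree \<Rightarrow> rtree" where
  "unshear_tree \<gamma> =
     map_tree (\<lambda>(a, b, c). (a, b - c * \<gamma>, c)) (\<lambda>(\<alpha>, \<beta>). (\<alpha> - \<beta> * \<gamma>, \<beta>))"

text \<open>
  The list \<open>zts\<close> is \<open>\<zeta>\<^sub>1, \<dots>, \<zeta>\<^sub>n\<close>, so \<open>\<zeta>\<^sub>k = zts ! (k - 1)\<close>.  The index \<open>k\<close> of nodes and
  coefficients starts at 1.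
\<close>

definition branch_node :: "complex list \<Rightarrow> nat \<Rightarrow> bipoly" where
  "branch_node zts k = (\<Prod>\<zeta> \<leftarrow> take (k - 1) zts. form_poly (1, - \<zeta>))"

definition branch_coef :: "bipoly \<Rightarrow> complex list \<Rightarrow> nat \<Rightarrow> affine" where
  "branch_coef p zts k =
     (let n = tdeg p; \<beta> = cf (branch_node zts k) (k - 2) 1 in
      if k = 1 then (cf p 0 0, cf p 1 0, cf p 0 1)
      else if k < n then (0, cf p k 0, cf p (k - 1) 1 - cf p k 0 * \<beta>)
      else (0, cf p n 0, - (cf p n 0 * zts ! (n - 1))))"

text \<open>A path with \<open>m\<close> edges whose first node has index \<open>k\<close>.\<close>

primrec path_tree :: "(nat \<Rightarrow> 'f) \<Rightarrow> (nat \<Rightarrow> 'e) \<Rightarrow> nat \<Rightarrow> nat \<Rightarrow> ('f, 'e) tree" where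
  "path_tree f e k 0 = Node (f k) []"
| "path_tree f e k (Suc m) = Node (f k) [(e k, path_tree f e (Suc k) m)]"

definition branch :: "bipoly \<Rightarrow> complex list \<Rightarrow> rtree" where
  "branch p zts = path_tree (branch_coef p zts) (\<lambda>k. (1, - (zts ! (k - 1)))) 1 (tdeg p - 1)"

fun attach :: "('f, 'e) tree \<Rightarrow> 'e \<Rightarrow> ('f, 'e) tree \<Rightarrow> ('f, 'e) tree" where
  "attach (Node f ts) e t = Node f (ts @ [(e, t)])"

definition remainder :: "bipoly \<Rightarrow> complex list \<Rightarrow> bipoly" where
  "remainder p zts =
     p - (\<Sum>k = 1..tdeg p. affine_poly (branch_coef p zts k) * branch_node zts k)"

text \<open>The polynomial \<open>s\<close> with \<open>r = y\<^sup>2 s\<close>; the division is exact.\<close>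

definition quotient :: "bipoly \<Rightarrow> complex list \<Rightarrow> bipoly" where
  "quotient p zts = remainder p zts div varY ^ 2"

text \<open>The result \<open>None\<close> stands for nontermination only.\<close>

partial_function (option) algT ::
  "(bipoly \<Rightarrow> complex list) \<Rightarrow> (bipoly \<Rightarrow> complex) \<Rightarrow> bipoly \<Rightarrow> rtree option" where
  "algT zs gam p =
     (if cf p (tdeg p) 0 = 0
      then Option.bind (algT zs gam (shear (gam p) p)) (\<lambda>G. Some (unshear_tree (gam p) G))
      else
        (let B = branch p (zs p); s = quotient p (zs p) in
         if s = 0 then Some B
         else if tdeg s = 0
         then Some (attach B (0, 1) (Node (0, 0, cf s 0 0) []))
         else Option.bind (algT zs gam s)
                (\<lambda>G. Some (attach B (0, 1) (Node (0, 0, 0) [((0, 1), G)])))))"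


section \<open>The degrees along a run, and the size\<close>

text \<open>The polynomial \<open>s\<close> that the algorithm computes from \<open>p\<close>, after a substitution if needed.\<close>

definition next_poly ::
  "(bipoly \<Rightarrow> complex list) \<Rightarrow> (bipoly \<Rightarrow> complex) \<Rightarrow> bipoly \<Rightarrow> bipoly" where
  "next_poly zs gam p =
     (let p' = (if cf p (tdeg p) 0 = 0 then shear (gam p) p else p) in quotient p' (zs p'))"

text \<open>
  The description of the algorithm says that \<open>s\<close> has degree \<open>n - 3\<close>.  For special \<open>p\<close> it may have
  smaller degree or vanish (for instance \<open>s = 0\<close> for \<open>p = x^4\<close>), and then the resulting tree can
  be smaller.  The following says that the degree is the stated one at every stage of the run on a
  polynomial \<open>p\<close> of degree \<open>n\<close>.
\<close>

definition full_degrees ::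
  "(bipoly \<Rightarrow> complex list) \<Rightarrow> (bipoly \<Rightarrow> complex) \<Rightarrow> bipoly \<Rightarrow> nat \<Rightarrow> bool" where
  "full_degrees zs gam p n \<longleftrightarrow>
     (\<forall>k. 3 * k \<le> n \<longrightarrow> has_degree ((next_poly zs gam ^^ k) p) (n - 3 * k))"

definition theta :: "nat \<Rightarrow> real" where
  "theta n = (if n mod 3 = 2 then real n * (real n + 5) / 6 - 1 / 3
              else real n * (real n + 5) / 6)"

end

theory Submission
  imports Defs
begin

text \<open>
  The node \<open>q\<^sub>k\<close> of the branch is homogeneous of degree \<open>k - 1\<close> and contains \<open>x^(k - 1)\<close> with
  coefficient 1, so \<open>f\<^sub>k q\<^sub>k\<close> reproduces the monomials \<open>x^k\<close> and \<open>x^(k - 1) y\<close> of \<open>p\<close>, and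
  \<open>f\<^sub>n q\<^sub>n\<close> is the whole homogeneous part of degree \<open>n\<close>.  Hence \<open>y\<^sup>2\<close> divides the remainder,
  whose degree is below \<open>n\<close>, and the recursive call is on a polynomial \<open>s\<close> of degree at most
  \<open>n - 3\<close>.  The size satisfies the recurrence \<open>\<theta>(n) = n + 1 + \<theta>(n - 3)\<close>, and since \<open>\<theta>\<close> is
  monotone a drop in the degree of \<open>s\<close> can only shrink the tree.
\<close>

section \<open>Coefficients and total degree\<close>

lemma cf_add: "cf (p + q) i j = cf p i j + cf q i j"
  by (simp add: cf_def)

lemma cf_diff: "cf (p - q) i j = cf p i j - cf q i j"
  by (simp add: cf_def)

lemma cf_sum: "cf (\<Sum>k\<in>A. g k) i j = (\<Sum>k\<in>A. cf (g k) i j)"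
  by (simp add: cf_def coeff_sum)

lemma cf_eqI: "(\<And>i j. cf p i j = cf q i j) \<Longrightarrow> p = q"
  by (simp add: cf_def poly_eq_iff)

lemma cf_affine_mult:
  "cf (affine_poly (a, b, c) * q) i j =
     a * cf q i j + (if i = 0 then 0 else b * cf q (i - 1) j) + (if j = 0 then 0 else c * cf q i (j - 1))"
  by (auto simp: cf_def coeff_pCons split: nat.splits)

lemma cf_1: "cf 1 i j = (if i = 0 \<and> j = 0 then 1 else 0)"
  by (auto simp: cf_def one_pCons coeff_pCons split: nat.splits)

lemma tdeg_eqI: "has_degree p n \<Longrightarrow> tdeg p = n"
  unfolding tdeg_def has_degree_def by (intro the_equality) (auto, metis le_antisym)

text \<open>For \<open>s\<close> only an upper bound on the degree is known; this supplies its true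
  degree. If no monomial attains the bound, the bound can be lowered by one.\<close>

lemma has_degree_exists:
  assumes "p \<noteq> 0" "\<And>i j. cf p i j \<noteq> 0 \<Longrightarrow> i + j \<le> n"
  shows "\<exists>m\<le>n. has_degree p m"
  using assms(2)
proof (induction n)
  case 0
  obtain i j where "cf p i j \<noteq> 0"
    using assms(1) cf_eqI[of p 0] by (auto simp: cf_def)
  with 0 show ?case by (force simp: has_degree_def)
next
  case (Suc n)
  show ?case
  proof (cases "\<exists>i j. i + j = Suc n \<and> cf p i j \<noteq> 0")
    case True
    with Suc.prems show ?thesis by (auto simp: has_degree_def)
  next
    case False
    have "i + j \<le> n" if "cf p i j \<noteq> 0" for i j
      using Suc.prems[OF that] False that le_Suc_eq by blast
    from Suc.IH[OF this] show ?thesis by (meson le_SucI)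
  qed
qed


section \<open>Products of linear forms\<close>

text \<open>Prefixes of the list of zeros give the nodes of the branch; the whole list gives, up to
  a scalar, the top homogeneous part of \<open>p\<close>.\<close>

definition forms_prod :: "complex list \<Rightarrow> bipoly" where
  "forms_prod zts = (\<Prod>\<zeta> \<leftarrow> zts. form_poly (1, - \<zeta>))"

lemma forms_prod_Cons: "forms_prod (z # zts) = affine_poly (0, 1, - z) * forms_prod zts"
  by (simp add: forms_prod_def)

lemma forms_prod_snoc: "forms_prod (zts @ [z]) = form_poly (1, - z) * forms_prod zts"
  by (simp add: forms_prod_def mult.commute del: form_poly.simps)

lemma forms_prod_homogeneous:
  "i + j \<noteq> length zts \<Longrightarrow> cf (forms_prod zts) i j = 0"
proof (induction zts arbitrary: i j)
  case (Cons z zts)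
  then show ?case by (simp only: forms_prod_Cons cf_affine_mult) auto
qed (auto simp: forms_prod_def cf_1)

lemma degree_prod_list_linear:
  "degree (\<Prod>\<zeta> \<leftarrow> zts. [:- \<zeta>, 1:]) = length (zts :: 'a::idom list)"
proof (induction zts)
  case (Cons z zts)
  have "(\<Prod>\<zeta> \<leftarrow> zts. [:- \<zeta>, 1:]) \<noteq> 0"
    by (auto simp: prod_list_zero_iff)
  then have "degree ([:- z, 1:] * (\<Prod>\<zeta> \<leftarrow> zts. [:- \<zeta>, 1:])) = 1 + degree (\<Prod>\<zeta> \<leftarrow> zts. [:- \<zeta>, 1:])"
    by (subst degree_mult_eq) auto
  with Cons show ?case by (simp del: mult_pCons_left)
qed simp

text \<open>Setting \<open>y = 1\<close> turns each \<open>x - \<zeta> y\<close> into a linear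
  factor in one variable, and by homogeneity no two monomials are merged.\<close>

lemma cf_forms_prod:
  "i + j = length zts \<Longrightarrow> cf (forms_prod zts) i j = coeff (\<Prod>\<zeta> \<leftarrow> zts. [:- \<zeta>, 1:]) i"
proof (induction zts arbitrary: i j)
  case (Cons z zts)
  let ?h = "\<Prod>\<zeta> \<leftarrow> zts. [:- \<zeta>, 1:]"
  \<comment> \<open>The induction hypothesis does not reach the case \<open>j = 0\<close>, where the
    recursion for the univariate product asks for a coefficient beyond the degree.\<close>
  have top: "coeff ?h (Suc (length zts)) = 0"
    by (intro coeff_eq_0) (simp add: degree_prod_list_linear)
  then show ?case
    using Cons.prems Cons.IH[of "i - 1" j] Cons.IH[of i "j - 1"] top
    by (simp only: forms_prod_Cons cf_affine_mult) (auto simp: coeff_pCons split: nat.splits)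
qed (auto simp: forms_prod_def cf_1)

lemma cf_forms_prod_lead: "cf (forms_prod zts) (length zts) 0 = 1"
proof (induction zts)
  case (Cons z zts)
  then show ?case by (simp only: forms_prod_Cons cf_affine_mult) auto
qed (auto simp: forms_prod_def cf_1)

section \<open>The zeros of \<open>h\<close>\<close>

lemma coeff_top_poly: "coeff (top_poly p) i = (if i \<le> tdeg p then cf p i (tdeg p - i) else 0)"
  by (auto simp: top_poly_def coeff_sum)

lemma top_poly_degree:
  assumes "cf p (tdeg p) 0 \<noteq> 0"
  shows "degree (top_poly p) = tdeg p" "lead_coeff (top_poly p) = cf p (tdeg p) 0"
proof -
  show *: "degree (top_poly p) = tdeg p"
    using assms by (intro antisym degree_le le_degree) (auto simp: coeff_top_poly)
  show "lead_coeff (top_poly p) = cf p (tdeg p) 0"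
    by (simp add: * coeff_top_poly)
qed

text \<open>This is the fundamental theorem of algebra; the nonzero coefficient of
  \<open>x^n\<close> makes the degree exactly \<open>n\<close>, so there are \<open>n\<close> zeros
  with multiplicity.\<close>

lemma top_poly_factor:
  assumes "cf p (tdeg p) 0 \<noteq> 0" "mset zts = proots (top_poly p)"
  shows "top_poly p = smult (cf p (tdeg p) 0) (\<Prod>\<zeta> \<leftarrow> zts. [:- \<zeta>, 1:])"
    and "length zts = tdeg p"
proof -
  have "(\<Prod>\<zeta> \<leftarrow> zts. [:- \<zeta>, 1:]) = (\<Prod>\<zeta>\<in>#mset zts. [:- \<zeta>, 1:])"
    by (metis mset_map prod_mset_prod_list)
  then show *: "top_poly p = smult (cf p (tdeg p) 0) (\<Prod>\<zeta> \<leftarrow> zts. [:- \<zeta>, 1:])"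
    using complex_poly_decompose_multiset[of "top_poly p"]
    unfolding top_poly_degree(2)[OF assms(1), symmetric] assms(2) by simp
  then have "degree (top_poly p) = length zts"
    using assms(1) by (simp add: degree_prod_list_linear)
  then show "length zts = tdeg p"
    by (simp add: top_poly_degree(1)[OF assms(1)])
qed


section \<open>The remainder\<close>

text \<open>
  Each \<open>f\<^sub>k q\<^sub>k\<close> with \<open>k \<ge> 2\<close> is homogeneous of degree \<open>k\<close>, so only one summand contributes to
  a given monomial.
\<close>

lemma cf_remainder_eq_0:
  assumes p: "has_degree p n" "n \<ge> 1" "cf p n 0 \<noteq> 0"
    and z: "mset zts = proots (top_poly p)"
    and ij: "j < 2 \<or> i + j \<ge> n"
  shows "cf (remainder p zts) i j = 0"
proof -
  have td: "tdeg p = n" using p(1) by (rule tdeg_eqI)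
  have len: "length zts = n" and
    top: "top_poly p = smult (cf p n 0) (\<Prod>\<zeta> \<leftarrow> zts. [:- \<zeta>, 1:])"
    using top_poly_factor[of p zts] p z td by auto
  \<comment> \<open>The index of the only summand that can contain \<open>x^i y^j\<close>: degrees 0
    and 1 both belong to \<open>k = 1\<close>.\<close>
  define d where "d = max 1 (i + j)"
  define T where "T k = cf (affine_poly (branch_coef p zts k) * branch_node zts k) i j" for k
  have node: "branch_node zts k = forms_prod (take (k - 1) zts)" for k
    by (simp add: branch_node_def forms_prod_def)
  have hom: "cf (branch_node zts k) a b = 0" if "k \<le> n" "a + b \<noteq> k - 1" for k a b
    unfolding node using that len by (intro forms_prod_homogeneous) auto
  have lead: "cf (branch_node zts k) (k - 1) 0 = 1" if "k \<le> n" for k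
    unfolding node using that len cf_forms_prod_lead[of "take (k - 1) zts"] by simp
  have one: "branch_node zts 1 = 1" by (simp add: branch_node_def)
  have T1: "T 1 = (if i + j \<le> 1 then cf p i j else 0)"
  proof -
    have "branch_coef p zts 1 = (cf p 0 0, cf p 1 0, cf p 0 1)" by (simp add: branch_coef_def)
    then show ?thesis unfolding T_def one
      by (simp only: cf_affine_mult cf_1) (cases i; cases j; auto simp: le_Suc_eq)
  qed
  have Tk: "T k = 0" if "k \<ge> 2" "k \<le> n" "i + j \<noteq> k" for k
    using that unfolding T_def branch_coef_def Let_def
    by (auto simp only: if_False if_True cf_affine_mult split: if_splits)
       (auto simp: hom)
  have "(\<Sum>k = 1..n. T k) = (\<Sum>k = 1..n. if k = d then T d else 0)"
  proof (intro sum.cong refl)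
    fix k assume k: "k \<in> {1..n}"
    then consider "k = d" | "k = 1" "k \<noteq> d" | "k \<ge> 2" "k \<noteq> d" by fastforce
    then show "T k = (if k = d then T d else 0)"
    proof cases
      case 2
      then show ?thesis using T1 by (auto simp: d_def max_def split: if_splits)
    next
      case 3
      then show ?thesis using Tk[of k] k by (auto simp: d_def)
    qed simp
  qed
  also have "\<dots> = (if d \<le> n then T d else 0)"
    by (simp add: d_def)
  also have "\<dots> = cf p i j"
  proof -
    \<comment> \<open>Only the last case, the intermediate degrees, needs \<open>j < 2\<close>; the
      others hold for every monomial.\<close>
    consider "i + j \<le> 1" | "i + j > n" "i + j \<ge> 2" | "i + j = n" "n \<ge> 2" | "i + j \<ge> 2" "i + j < n"
      by linarith
    then show ?thesis
    proof cases
      case 1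
      then show ?thesis using T1 p(2) by (simp add: d_def max_def)
    next
      case 2
      moreover from this have "cf p i j = 0" using p(1) unfolding has_degree_def by (meson not_less)
      ultimately show ?thesis by (simp add: d_def)
    next
      case 3
      let ?z = "zts ! (n - 1)"
      have "take n zts = take (n - 1) zts @ [?z]"
        using 3 len by (metis Suc_diff_1 diff_less not_numeral_le_zero not_gr_zero take_Suc_conv_app_nth zero_less_one)
      \<comment> \<open>The form in \<open>f\<^sub>n\<close> supplies the last factor, so
        \<open>f\<^sub>n q\<^sub>n\<close> is a multiple of the full product.\<close>
      then have fp: "forms_prod zts = form_poly (1, - ?z) * branch_node zts n"
        unfolding node using len forms_prod_snoc[of "take (n - 1) zts" ?z] by simp
      have "branch_coef p zts n = (0, cf p n 0, - (cf p n 0 * ?z))"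
        using 3 by (simp add: branch_coef_def td)
      then have "T n = cf p n 0 * cf (forms_prod zts) i j"
        unfolding fp T_def by (simp only: form_poly.simps cf_affine_mult) (simp add: algebra_simps)
      also have "\<dots> = coeff (top_poly p) i"
        using cf_forms_prod[of i j zts] 3 len top by simp
      also have "\<dots> = cf p i j"
        using 3 td by (auto simp: coeff_top_poly)
      finally show ?thesis using 3 by (simp add: d_def)
    next
      case 4
      let ?k = "i + j"
      have j: "j = 0 \<or> j = 1" using ij 4 by auto
      have "branch_coef p zts ?k =
          (0, cf p ?k 0, cf p (?k - 1) 1 - cf p ?k 0 * cf (branch_node zts ?k) (?k - 2) 1)"
        using 4 by (simp add: branch_coef_def td Let_def)
      \<comment> \<open>For \<open>j = 1\<close> the product of \<open>x\<close> with the monomial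
        \<open>x^(k - 2) y\<close> of the node contributes an extra term, which the correction in
        the coefficient cancels.\<close>
      then have "T ?k = cf p i j"
        unfolding T_def using 4 j lead[of ?k]
        by (simp only: cf_affine_mult) (auto simp: hom)
      then show ?thesis using 4 by (simp add: d_def max_def)
    qed
  qed
  finally show ?thesis
    by (simp add: remainder_def cf_diff cf_sum T_def td del: One_nat_def)
qed

text \<open>The first two coefficients in \<open>y\<close> vanish, so the remainder is
  \<open>y^2\<close> times its shift by two; cancelling \<open>y^2\<close> shows that
  \<open>div\<close> returns this shift.\<close>

lemma remainder_quotient:
  assumes "\<And>i j. j < 2 \<Longrightarrow> cf (remainder p zts) i j = 0"
  shows "remainder p zts = varY ^ 2 * quotient p zts"
    and "cf (quotient p zts) i j = cf (remainder p zts) i (j + 2)"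
proof -
  let ?r = "remainder p zts"
  have Y: "varY ^ 2 = monom 1 2"
    by (simp add: varY_def power2_eq_square monom_Suc numeral_2_eq_2 one_pCons monom_0)
  have "coeff ?r j = 0" if "j < 2" for j
    using assms[OF that] by (simp add: cf_def poly_eq_iff)
  then have *: "?r = varY ^ 2 * poly_shift 2 ?r"
    unfolding Y by (intro poly_eqI) (auto simp: coeff_monom_mult coeff_poly_shift simp del: add_2_eq_Suc')
  have "quotient p zts = poly_shift 2 ?r"
    unfolding quotient_def by (subst *, rule nonzero_mult_div_cancel_left) (simp add: varY_def)
  with * show "?r = varY ^ 2 * quotient p zts" "cf (quotient p zts) i j = cf ?r i (j + 2)"
    by (simp_all add: cf_def coeff_poly_shift)
qed


section \<open>The substitution\<close>

lemma shear_mult: "shear \<gamma> (p * q) = shear \<gamma> p * shear \<gamma> q"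
  by (simp add: shear_def pcompose_mult)

lemma shear_1: "shear \<gamma> 1 = 1"
  by (simp add: shear_def one_pCons)

lemma shear_sum_list: "shear \<gamma> (sum_list ps) = (\<Sum>p \<leftarrow> ps. shear \<gamma> p)"
  by (induction ps) (auto simp: shear_def pcompose_add)

lemma shear_inverse: "shear (- \<gamma>) (shear \<gamma> p) = p"
proof -
  have "pcompose [:[:0, \<gamma>:], 1:] [:[:0, - \<gamma>:], 1:] = ([:0, 1:] :: bipoly)"
    by (simp add: pcompose_pCons)
  then show ?thesis
    by (simp add: shear_def pcompose_assoc[symmetric] pcompose_idR)
qed

text \<open>The offset \<open>m\<close> makes the bound inductive along the coefficients of \<open>p\<close>.\<close>

lemma shear_degree_le:
  assumes "\<And>i j. cf p i j \<noteq> 0 \<Longrightarrow> i + j + m \<le> n"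
  shows "cf (shear \<gamma> p) i j \<noteq> 0 \<Longrightarrow> i + j + m \<le> n"
  using assms
proof (induction p arbitrary: m i j)
  case 0
  then show ?case by (simp add: shear_def cf_def)
next
  case (pCons a p)
  have IH: "i + j + Suc m \<le> n" if "cf (shear \<gamma> p) i j \<noteq> 0" for i j
  proof (rule pCons.IH[OF that])
    fix i j assume "cf p i j \<noteq> 0"
    then have "cf (pCons a p) i (Suc j) \<noteq> 0" by (simp add: cf_def)
    from pCons.prems(2)[OF this] show "i + j + Suc m \<le> n" by simp
  qed
  \<comment> \<open>A Horner step: \<open>a\<close> is free of \<open>y\<close> and stays fixed,
    while the tail gains a factor of degree one.\<close>
  have "shear \<gamma> (pCons a p) = [:a:] + affine_poly (0, \<gamma>, 1) * shear \<gamma> p"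
    by (simp add: shear_def pcompose_pCons one_pCons)
  then have *: "cf (shear \<gamma> (pCons a p)) i j = cf [:a:] i j +
      (if i = 0 then 0 else \<gamma> * cf (shear \<gamma> p) (i - 1) j) + (if j = 0 then 0 else cf (shear \<gamma> p) i (j - 1))"
    by (simp only: cf_add cf_affine_mult) simp
  consider "cf [:a:] i j \<noteq> 0" | "i \<noteq> 0" "cf (shear \<gamma> p) (i - 1) j \<noteq> 0" | "j \<noteq> 0" "cf (shear \<gamma> p) i (j - 1) \<noteq> 0"
    using pCons.prems(1) unfolding *
    by (cases "cf [:a:] i j = 0"; cases "cf (shear \<gamma> p) (i - 1) j = 0") (auto split: if_splits)
  then show ?case
  proof cases
    case 1
    then have "cf (pCons a p) i j \<noteq> 0" by (auto simp: cf_def coeff_pCons split: nat.splits)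
    then show ?thesis by (rule pCons.prems(2))
  next
    case 2
    then show ?thesis using IH[of "i - 1" j] by simp
  next
    case 3
    then show ?thesis using IH[of i "j - 1"] by simp
  qed
qed


section \<open>Trees\<close>

text \<open>The root polynomial is a parameter so that subtrees can be evaluated in place.\<close>

definition tree_sum :: "bipoly \<Rightarrow> rtree \<Rightarrow> bipoly" where
  "tree_sum q G = (\<Sum>(f, q) \<leftarrow> nodes_from q G. affine_poly f * q)"

lemma representation_tree_iff:
  "representation_tree G p \<longleftrightarrow> (0, 0) \<notin> set (edges G) \<and> tree_sum 1 G = p"
  by (auto simp: representation_tree_def tree_sum_def nodes_def)

lemma nodes_from_mult:
  "nodes_from (r * q) G = map (\<lambda>(f, q). (f, r * q)) (nodes_from q G)"
proof (induction q G rule: nodes_from.induct)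
  case (1 q f ts)
  have "nodes_from (form_poly e * (r * q)) t = map (\<lambda>(f, q). (f, r * q)) (nodes_from (form_poly e * q) t)"
    if "(e, t) \<in> set ts" for e t
    using 1[OF that refl] by (simp add: mult.left_commute)
  then show ?case
    by (auto simp: map_concat intro!: arg_cong[of _ _ concat] map_cong)
qed

text \<open>Below two edges with factor \<open>y\<close>, a tree for \<open>s\<close> thus
  contributes \<open>y^2 s\<close>.\<close>

lemma tree_sum_eq: "tree_sum q G = q * tree_sum 1 G"
proof -
  have "nodes_from q G = map (\<lambda>(f, r). (f, q * r)) (nodes_from 1 G)"
    using nodes_from_mult[of q 1 G] by simp
  then show ?thesis
    by (simp add: tree_sum_def case_prod_unfold comp_def sum_list_const_mult[symmetric] mult.left_commute)
qed

text \<open>Sizes are counted through \<open>edges\<close>, which needs no root polynomial and is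
  easy to follow through \<open>attach\<close>, \<open>path_tree\<close> and
  \<open>map_tree\<close>.\<close>

lemma length_nodes_from: "length (nodes_from q G) = Suc (length (edges G))"
proof (induction q G rule: nodes_from.induct)
  case (1 q f ts)
  have "length (nodes_from (form_poly e * q) t) = Suc (length (edges t))" if "(e, t) \<in> set ts" for e t
    using 1[OF that refl] .
  then show ?case
    by (auto simp: length_concat comp_def case_prod_unfold intro!: arg_cong[of _ _ sum_list] map_cong)
qed

lemma num_nodes_eq: "num_nodes G = Suc (length (edges G))"
  by (simp add: num_nodes_def nodes_def length_nodes_from)

lemma edges_attach: "edges (attach B e t) = edges B @ e # edges t"
  by (cases B) simp

lemma tree_sum_attach: "tree_sum q (attach B e t) = tree_sum q B + tree_sum (form_poly e * q) t"
  by (cases B) (simp add: tree_sum_def)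

lemma edges_path_tree: "edges (path_tree f e k m) = map e [k..<k + m]"
  by (induction m arbitrary: k) (simp_all add: upt_rec del: upt_Suc)

lemma nodes_from_path_tree:
  assumes "\<And>i. k \<le> i \<Longrightarrow> i < k + m \<Longrightarrow> Q (Suc i) = form_poly (e i) * Q i"
  shows "nodes_from (Q k) (path_tree f e k m) = map (\<lambda>i. (f i, Q i)) [k..<Suc (k + m)]"
  using assms
proof (induction m arbitrary: k)
  case (Suc m)
  have "Q (Suc k) = form_poly (e k) * Q k" using Suc.prems by simp
  moreover have "nodes_from (Q (Suc k)) (path_tree f e (Suc k) m) = map (\<lambda>i. (f i, Q i)) [Suc k..<Suc (Suc k + m)]"
    using Suc.prems by (intro Suc.IH) auto
  ultimately show ?case by (simp add: upt_rec[of k] del: upt_Suc)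
qed simp

lemma edges_map_tree: "edges (map_tree f g t) = map g (edges t)"
proof (induction t rule: edges.induct)
  case (1 u ts)
  have "edges (map_tree f g t) = map g (edges t)" if "(e, t) \<in> set ts" for e t
    using 1[OF that refl] .
  then show ?case
    by (auto simp: map_concat comp_def case_prod_unfold intro!: arg_cong[of _ _ concat] map_cong)
qed

lemma affine_poly_unshear:
  "affine_poly (case f of (a, b, c) \<Rightarrow> (a, b - c * \<gamma>, c)) = shear (- \<gamma>) (affine_poly f)"
  by (cases f) (simp add: shear_def pcompose_pCons one_pCons)

lemma form_poly_unshear:
  "form_poly (\<alpha> - \<beta> * \<gamma>, \<beta>) = shear (- \<gamma>) (form_poly (\<alpha>, \<beta>))"
  by (simp add: shear_def pcompose_pCons one_pCons)

text \<open>The substitution is a ring homomorphism, so it commutes with the products along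
  paths.\<close>

lemma nodes_from_unshear:
  "nodes_from (shear (- \<gamma>) q) (unshear_tree \<gamma> G) =
     map (\<lambda>(f, q). (case f of (a, b, c) \<Rightarrow> (a, b - c * \<gamma>, c), shear (- \<gamma>) q)) (nodes_from q G)"
proof (induction q G rule: nodes_from.induct)
  case (1 q f ts)
  have "nodes_from (shear (- \<gamma>) (form_poly e) * shear (- \<gamma>) q) (unshear_tree \<gamma> t) =
      map (\<lambda>(f, q). (case f of (a, b, c) \<Rightarrow> (a, b - c * \<gamma>, c), shear (- \<gamma>) q)) (nodes_from (form_poly e * q) t)"
    if "(e, t) \<in> set ts" for e t
    using 1[OF that refl] by (simp add: shear_mult)
  then show ?case
    by (auto simp: unshear_tree_def map_concat comp_def map_prod_def form_poly_unshear
        simp del: form_poly.simps intro!: arg_cong[of _ _ concat] map_cong)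
qed

lemma tree_sum_unshear: "tree_sum 1 (unshear_tree \<gamma> G) = shear (- \<gamma>) (tree_sum 1 G)"
  using nodes_from_unshear[of \<gamma> 1 G]
  by (simp add: shear_1 tree_sum_def shear_sum_list comp_def case_prod_unfold
      affine_poly_unshear[unfolded case_prod_unfold] shear_mult del: affine_poly.simps)

lemma representation_tree_unshear:
  assumes "representation_tree G (shear \<gamma> p)"
  shows "representation_tree (unshear_tree \<gamma> G) p"
  using assms unfolding representation_tree_iff tree_sum_unshear
  \<comment> \<open>Edges stay nonzero: \<open>\<beta> = 0\<close> and
    \<open>\<alpha> - \<beta> * \<gamma> = 0\<close> force \<open>\<alpha> = 0\<close>.\<close>
  by (auto simp: unshear_tree_def edges_map_tree shear_inverse)

lemma tree_sum_branch:
  assumes "tdeg p \<ge> 1" "length zts = tdeg p"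
  shows "tree_sum 1 (branch p zts) = p - remainder p zts"
proof -
  let ?n = "tdeg p"
  have "nodes_from (branch_node zts 1) (branch p zts) =
      map (\<lambda>k. (branch_coef p zts k, branch_node zts k)) [1..<Suc (1 + (?n - 1))]"
    unfolding branch_def
  proof (rule nodes_from_path_tree)
    fix i assume "1 \<le> i" "i < 1 + (?n - 1)"
    then have "take i zts = take (i - 1) zts @ [zts ! (i - 1)]"
      using assms take_Suc_conv_app_nth[of "i - 1" zts] by simp
    then show "branch_node zts (Suc i) = form_poly (1, - (zts ! (i - 1))) * branch_node zts i"
      by (simp add: branch_node_def)
  qed
  moreover have "branch_node zts 1 = 1" by (simp add: branch_node_def)
  moreover have "set [1..<Suc ?n] = {1..?n}" by auto
  ultimately show ?thesis
    using assms by (simp add: tree_sum_def remainder_def comp_def sum_list_distinct_conv_sum_set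
        del: upt_Suc affine_poly.simps)
qed

lemma edges_branch:
  "edges (branch p zts) = map (\<lambda>k. (1, - (zts ! (k - 1)))) [1..<1 + (tdeg p - 1)]"
  by (simp only: branch_def edges_path_tree)


section \<open>The size\<close>

text \<open>The \<open>n + 1\<close> counts the branch and the extra node below the root. The
  corrections cancel since \<open>n\<close> and \<open>n - 3\<close> agree modulo 3.\<close>

lemma theta_rec:
  assumes "n \<ge> 3"
  shows "theta n = real n + 1 + theta (n - 3)"
proof -
  obtain m where "n = m + 3" using assms by (metis add.commute le_Suc_ex)
  then show ?thesis by (auto simp: theta_def field_simps)
qed

text \<open>From \<open>n\<close> to \<open>n + 1\<close> the quadratic term grows by
  \<open>(n + 3) / 3\<close>, more than the correction \<open>1 / 3\<close> can take away.\<close>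

lemma theta_mono: "m \<le> n \<Longrightarrow> theta m \<le> theta n"
proof (rule lift_Suc_mono_le[of theta])
  fix n :: nat
  have "n mod 3 = 2 \<Longrightarrow> n \<ge> 2" by (metis mod_less_eq_dividend)
  then show "theta n \<le> theta (Suc n)" by (auto simp: theta_def field_simps)
qed

lemma theta_0: "theta 0 = 0" and theta_1: "theta 1 = 1" and theta_2: "theta 2 = 2"
  by (simp_all add: theta_def)

text \<open>This bounds the bare branch, which is the whole tree when \<open>s = 0\<close>.\<close>

lemma le_theta: "real n \<le> theta n"
proof -
  consider "n = 0" | "n = 1" | "n = 2" | "n \<ge> 3" by linarith
  then show ?thesis
  proof cases
    case 4
    then show ?thesis using theta_rec[of n] theta_mono[of 0 "n - 3"] theta_0 by simp
  qed (simp_all add: theta_0 theta_1[simplified] theta_2)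
qed

lemma full_degrees_next:
  assumes "full_degrees zs gam p n" "n \<ge> 3"
  shows "has_degree (next_poly zs gam p) (n - 3)"
    and "full_degrees zs gam (next_poly zs gam p) (n - 3)"
proof -
  show *: "full_degrees zs gam (next_poly zs gam p) (n - 3)"
    unfolding full_degrees_def
  proof (intro allI impI)
    fix k assume "3 * k \<le> n - 3"
    then have "3 * Suc k \<le> n" using assms(2) by simp
    with assms(1) have "has_degree ((next_poly zs gam ^^ Suc k) p) (n - 3 * Suc k)"
      unfolding full_degrees_def by blast
    then show "has_degree ((next_poly zs gam ^^ k) (next_poly zs gam p)) (n - 3 - 3 * k)"
      by (simp only: funpow_Suc_right comp_apply) simp
  qed
  from this[unfolded full_degrees_def, rule_format, of 0]
  show "has_degree (next_poly zs gam p) (n - 3)" by simp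
qed


section \<open>Runs of the algorithm\<close>

definition good_run ::
  "(bipoly \<Rightarrow> complex list) \<Rightarrow> (bipoly \<Rightarrow> complex) \<Rightarrow> bipoly \<Rightarrow> nat \<Rightarrow> bool" where
  "good_run zs gam p n \<longleftrightarrow>
     (\<exists>G. algT zs gam p = Some G \<and> representation_tree G p \<and> real (num_nodes G) \<le> theta n \<and>
        (full_degrees zs gam p n \<longrightarrow> real (num_nodes G) = theta n))"

text \<open>One pass without substitution, split by its three exits. A constant \<open>s\<close> is
  handled directly, so the hypothesis on smaller degrees can start at 1.\<close>

lemma good_run_of_lead_nonzero:
  assumes p: "has_degree p n" "n \<ge> 1" "cf p n 0 \<noteq> 0" and zs: "zeros_choice zs"
    and IH: "\<And>m s. 1 \<le> m \<Longrightarrow> m < n \<Longrightarrow> has_degree s m \<Longrightarrow> good_run zs gam s m"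
  shows "good_run zs gam p n"
proof -
  have td: "tdeg p = n" using p(1) by (rule tdeg_eqI)
  have z: "mset (zs p) = proots (top_poly p)" using zs by (simp add: zeros_choice_def)
  have len: "length (zs p) = n" using top_poly_factor(2)[OF _ z] p(3) td by simp
  define B where "B = branch p (zs p)"
  define s where "s = quotient p (zs p)"
  have r0: "cf (remainder p (zs p)) i j = 0" if "j < 2 \<or> i + j \<ge> n" for i j
    using cf_remainder_eq_0[OF p z that] .
  have r: "remainder p (zs p) = varY ^ 2 * s" and
    cf_s: "\<And>i j. cf s i j = cf (remainder p (zs p)) i (j + 2)"
    using remainder_quotient[of p "zs p"] r0 by (auto simp: s_def)
  have s_deg: "i + j + 3 \<le> n" if "cf s i j \<noteq> 0" for i j
    using r0[of "j + 2" i] that unfolding cf_s by linarith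
  have s_eq: "next_poly zs gam p = s"
    using p(3) td by (simp add: next_poly_def s_def)
  have sumB: "tree_sum 1 B + varY ^ 2 * s = p"
    using tree_sum_branch[of p "zs p"] p(2) td len r by (simp add: B_def)
  have edgB: "(0, 0) \<notin> set (edges B)" "Suc (length (edges B)) = n"
    using p(2) td by (auto simp: B_def edges_branch)
  have Y: "form_poly (0, 1) = varY" by (simp add: varY_def one_pCons)
  have full_n: "n < 3 \<or> has_degree s (n - 3)" if "full_degrees zs gam p n"
    using full_degrees_next(1)[OF that] s_eq by (cases "n < 3") auto
  have alg: "algT zs gam p = 
      (if s = 0 then Some B
       else if tdeg s = 0 then Some (attach B (0, 1) (Node (0, 0, cf s 0 0) []))
       else Option.bind (algT zs gam s) (\<lambda>G. Some (attach B (0, 1) (Node (0, 0, 0) [((0, 1), G)]))))"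
    using p(3) by (subst algT.simps) (simp add: td B_def s_def Let_def)
  show ?thesis
  proof (cases "s = 0")
    case True
    \<comment> \<open>Full degrees exclude \<open>s = 0\<close> for \<open>n \<ge> 3\<close>, and
      \<open>theta n = n\<close> for \<open>n = 1, 2\<close>.\<close>
    have "real n = theta n" if "full_degrees zs gam p n"
    proof -
      from full_n[OF that] True have "n < 3" by (auto simp: has_degree_def cf_def)
      then have "n = 1 \<or> n = 2" using p(2) by auto
      then show ?thesis using theta_1 theta_2 by auto
    qed
    then show ?thesis
      using True alg sumB edgB le_theta[of n] num_nodes_eq[of B]
      by (simp add: good_run_def representation_tree_iff)
  next
    case False
    then obtain i j where "cf s i j \<noteq> 0" using cf_eqI[of s 0] by (auto simp: cf_def)
    from s_deg[OF this] have n3: "n \<ge> 3" by simp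
    have "i + j \<le> n - 3" if "cf s i j \<noteq> 0" for i j
      using s_deg[OF that] by simp
    from has_degree_exists[OF False this]
    obtain m where m: "m \<le> n - 3" "has_degree s m" by blast
    have tds: "tdeg s = m" using m(2) by (rule tdeg_eqI)
    have full_m: "m = n - 3" if "full_degrees zs gam p n"
      using full_n[OF that] n3 tdeg_eqI tds by auto
    have th: "theta m \<le> theta (n - 3)" using m(1) by (rule theta_mono)
    show ?thesis
    proof (cases "m = 0")
      case True
      define c where "c = cf s 0 0"
      have "s = [:[:c:]:]"
      proof (rule cf_eqI)
        fix i j show "cf s i j = cf [:[:c:]:] i j"
          using m(2) True by (cases i; cases j) (auto simp: has_degree_def cf_def c_def)
      qed
      then have "affine_poly (0, 0, cf s 0 0) = varY * s"
        unfolding c_def[symmetric] by (simp add: varY_def)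
      then have "tree_sum varY (Node (0, 0, cf s 0 0) []) = varY ^ 2 * s"
        by (simp add: tree_sum_def power2_eq_square mult.left_commute mult.commute del: affine_poly.simps)
      then have "representation_tree (attach B (0, 1) (Node (0, 0, cf s 0 0) [])) p"
        using sumB edgB by (simp add: representation_tree_iff edges_attach tree_sum_attach Y del: form_poly.simps)
      \<comment> \<open>Since \<open>theta 0 = 0\<close>, the size \<open>n + 1\<close> fits the
        same recurrence as the recursive exit.\<close>
      moreover have "real (num_nodes (attach B (0, 1) (Node (0, 0, cf s 0 0) []))) = real n + 1 + theta m"
        using edgB True theta_0 by (simp add: num_nodes_eq edges_attach)
      moreover have "algT zs gam p = Some (attach B (0, 1) (Node (0, 0, cf s 0 0) []))"
        using alg False tds True by simp
      ultimately show ?thesis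
        using theta_rec[OF n3] th full_m by (auto simp: good_run_def)
    next
      case m0: False
      then have "1 \<le> m" "m < n" using m(1) n3 by auto
      from IH[OF this m(2)] obtain G where
        G: "algT zs gam s = Some G" "representation_tree G s" "real (num_nodes G) \<le> theta m"
          "full_degrees zs gam s m \<longrightarrow> real (num_nodes G) = theta m"
        unfolding good_run_def by auto
      let ?G = "attach B (0, 1) (Node (0, 0, 0) [((0, 1), G)])"
      have "tree_sum varY (Node (0, 0, 0) [((0, 1), G)]) = tree_sum (varY * varY) G"
        by (simp add: tree_sum_def Y del: form_poly.simps)
      also have "\<dots> = varY ^ 2 * s"
        using G(2) tree_sum_eq[of "varY * varY" G] by (simp add: representation_tree_iff power2_eq_square)
      finally have "representation_tree ?G p"
        using sumB edgB G(2) by (simp add: representation_tree_iff edges_attach tree_sum_attach Y del: form_poly.simps)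
      moreover have "real (num_nodes ?G) = real n + 1 + real (num_nodes G)"
        using edgB by (simp add: num_nodes_eq edges_attach)
      moreover have "algT zs gam p = Some ?G"
        using alg False tds m0 G(1) by simp
      moreover have "real (num_nodes G) = theta (n - 3)" if "full_degrees zs gam p n"
        using G(4) full_m[OF that] full_degrees_next(2)[OF that n3] s_eq by simp
      ultimately show ?thesis
        using theta_rec[OF n3] th G(3) by (auto simp: good_run_def)
    qed
  qed
qed

text \<open>Substituting back relabels the tree without changing its shape, so the size carries
  over.\<close>

lemma good_run_shear:
  assumes p: "has_degree p n" "cf p n 0 = 0" and q: "q = shear (gam p) p"
    and q_deg: "has_degree q n" "cf q n 0 \<noteq> 0" and run: "good_run zs gam q n"
  shows "good_run zs gam p n"
proof -
  have td: "tdeg p = n" "tdeg q = n" using p(1) q_deg(1) by (auto intro: tdeg_eqI)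
  from run obtain G where
    G: "algT zs gam q = Some G" "representation_tree G q" "real (num_nodes G) \<le> theta n"
      "full_degrees zs gam q n \<longrightarrow> real (num_nodes G) = theta n"
    unfolding good_run_def by auto
  have "algT zs gam p = Some (unshear_tree (gam p) G)"
    using p(2) td G(1) q by (subst algT.simps) simp
  moreover have "representation_tree (unshear_tree (gam p) G) p"
    using G(2) q representation_tree_unshear by simp
  moreover have "num_nodes (unshear_tree (gam p) G) = num_nodes G"
    by (simp add: num_nodes_eq unshear_tree_def edges_map_tree)
  moreover have "full_degrees zs gam q n" if "full_degrees zs gam p n"
    unfolding full_degrees_def
  proof (intro allI impI)
    fix k assume k: "3 * k \<le> n"
    \<comment> \<open>\<open>next_poly\<close> performs the substitution itself, so the iterates
      from \<open>p\<close> and \<open>q\<close> agree from the first step on; only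
      \<open>k = 0\<close> needs the degree of \<open>q\<close>.\<close>
    have "next_poly zs gam q = next_poly zs gam p"
      using td p(2) q q_deg(2) by (simp add: next_poly_def)
    then show "has_degree ((next_poly zs gam ^^ k) q) (n - 3 * k)"
      using that[unfolded full_degrees_def, rule_format, OF k] q_deg(1)
      by (cases k) (simp_all only: funpow_Suc_right comp_apply, simp)
  qed
  ultimately show ?thesis using G(3,4) unfolding good_run_def by auto
qed

theorem lemma6p3:
  fixes p :: bipoly and n :: nat
    and zs :: "bipoly \<Rightarrow> complex list" and gam :: "bipoly \<Rightarrow> complex"
  assumes "n \<ge> 1" and "has_degree p n"
    and "zeros_choice zs" and "shear_choice gam"
  shows "\<exists>G. algT zs gam p = Some G \<and> representation_tree G p \<and>
           real (num_nodes G) \<le> theta n \<and>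
           (full_degrees zs gam p n \<longrightarrow> real (num_nodes G) = theta n)"
proof -
  have "good_run zs gam p n"
    using assms(1,2)
  proof (induction n arbitrary: p rule: less_induct)
    case (less n)
    \<comment> \<open>Stated for every \<open>q\<close> of degree \<open>n\<close>, because the
      substitution keeps the degree and its result is out of reach of the induction
      hypothesis.\<close>
    have lead_nonzero: "good_run zs gam q n" if "has_degree q n" "cf q n 0 \<noteq> 0" for q
      using less.IH by (rule good_run_of_lead_nonzero[OF that(1) less.prems(1) that(2) assms(3)])
    show ?case
    proof (cases "cf p n 0 = 0")
      case True
      have td: "tdeg p = n" using less.prems(2) by (rule tdeg_eqI)
      have "p \<noteq> 0" using less.prems(2) by (auto simp: has_degree_def cf_def)
      with assms(4) True td have lead: "cf (shear (gam p) p) n 0 \<noteq> 0"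
        by (auto simp: shear_choice_def)
      \<comment> \<open>The substitution cannot raise the degree, and the coefficient of
        \<open>x^n\<close> is now nonzero, so the degree is again \<open>n\<close>.\<close>
      have "i + j \<le> n" if "cf (shear (gam p) p) i j \<noteq> 0" for i j
        using shear_degree_le[of p 0 n "gam p" i j] that less.prems(2) by (simp add: has_degree_def)
      with lead have "has_degree (shear (gam p) p) n"
        unfolding has_degree_def by (metis add_0_right)
      from good_run_shear[OF less.prems(2) True refl this lead lead_nonzero[OF this lead]]
      show ?thesis .
    next
      case False
      with less.prems(2) show ?thesis by (rule lead_nonzero)
    qed
  qed
  then show ?thesis by (simp add: good_run_def)
qed

end
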